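(* Let $m(x)$ be supermodular and $(x,y)\in G$. Let (A) denote the inequality $$\frac{u\,m(x^0)-\ell\,m(x^n)}{u-\ell}+\sum_{j=1}^n\beta_jx_j-y\ge 0,\qquad \beta_j=\frac{m(x^j)-m(x^{j-1})}{u-\ell}\ (j\in N),$$ and, for $k\in N$, let (B$_k$) denote the inequality $$-m(x^k)-\left(\frac{m(x^k)-m(x^{k-1})}{u-\ell}\right)\left(\sum_{j=1}^nx_j-[ku+(n-k)\ell]\right)+y\ge 0.$$ 1. $(x,y)$ satisfies (A) exactly if and only if $x=x^k$ for some $k\in\{0,\dots,n\}$, or $\beta_r=\cdots=\beta_s$ where $r=\min\{j:x_j<u\}$ and $s=\max\{j:x_j>\ell\}$. 2. For each $k\in N$, $(x,y)$ satisfies (B$_k$) exactly if and only if $(x^j,m(x^j))$ satisfies (B$_k$) exactly for $j=p,\dots,n-q$, where $p=|\{j:x_j=u\}|$ and $q=|\{j:x_j=\ell\}|$. 3. For each $k\in N$, $(x,y)$ satisfies (B$_k$) exactly if and only if $|\{j:x_j=u\}|\ge v$ and $|\{j:x_j=\ell\}|\ge n-w$, where $v$ and $w$ are the smallest and largest, respectively, values of $j\in\{0,\dots,n\}$ such that the point $(x^j,m(x^j))$ satisfies (B$_k$) exactly.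
   Context: Let $n\ge 2$, $N=\{1,\dots,n\}$, and let $\ell<u$ be real numbers. Let $X=\{x\in\mathbb{R}^n:\ell\le x_j\le u,\ j\in N\}$. For real coefficients $c_2,\dots,c_n$ let $m(x)=\sum_{i=2}^n c_i\sum_{J\subseteq N,\ |J|=i}\prod_{j\in J}x_j$, and let $G=\{(x,y)\in\mathbb{R}^n\times\mathbb{R}: x\in X,\ y=m(x)\}$. For $k=0,\dots,n$, $x^k\in\mathbb{R}^n$ denotes the point whose first $k$ entries equal $u$ and whose last $n-k$ entries equal $\ell$ (superscripts are not powers). "$m(x)$ is supermodular" means supermodular over the $2^n$ extreme points of $X$: the set function $f(A)=m(x)$, with $x_j=u$ for $j\in A$ and $x_j=\ell$ for $j\notin A$, satisfies $f(S\cup\{r\})-f(S)\le f(S\cup\{r,t\})-f(S\cup\{t\})$ for all distinct $r,t\in N$ and $S\subseteq N\setminus\{r,t\}$; by symmetry of $m$ this is equivalent to $m(x^k)-m(x^{k-1})\le m(x^{k+1})-m(x^k)$ for all $k\in\{1,\dots,n-1\}$. "Satisfied exactly" means satisfied with equality. *)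

theory Defs
  imports Complex_Main "HOL-Library.FuncSet"
begin

text \<open>
  Points of \<open>\<real>\<^sup>n\<close> are extensional functions on \<open>{1..n}\<close> (value \<open>undefined\<close> elsewhere), so
  equality of functions is equality of points.
\<close>

definition box :: "nat \<Rightarrow> real \<Rightarrow> real \<Rightarrow> (nat \<Rightarrow> real) set" where
  "box n l u = {1..n} \<rightarrow>\<^sub>E {l..u}"

definition sym_multilinear :: "nat \<Rightarrow> (nat \<Rightarrow> real) \<Rightarrow> (nat \<Rightarrow> real) \<Rightarrow> real" where
  "sym_multilinear n c x =
    (\<Sum>i = 2..n. c i * (\<Sum>J | J \<subseteq> {1..n} \<and> card J = i. \<Prod>j\<in>J. x j))"

definition graph_set :: "nat \<Rightarrow> real \<Rightarrow> real \<Rightarrow> (nat \<Rightarrow> real) \<Rightarrow> ((nat \<Rightarrow> real) \<times> real) set" where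
  "graph_set n l u c = {(x, y). x \<in> box n l u \<and> y = sym_multilinear n c x}"

definition vertex :: "nat \<Rightarrow> real \<Rightarrow> real \<Rightarrow> nat set \<Rightarrow> nat \<Rightarrow> real" where
  "vertex n l u A = (\<lambda>j\<in>{1..n}. if j \<in> A then u else l)"

text \<open>The point \<open>x\<^sup>k\<close>, where the superscript is an index.\<close>

definition xpt :: "nat \<Rightarrow> real \<Rightarrow> real \<Rightarrow> nat \<Rightarrow> nat \<Rightarrow> real" where
  "xpt n l u k = (\<lambda>j\<in>{1..n}. if j \<le> k then u else l)"

definition supermodular_on :: "'a set \<Rightarrow> ('a set \<Rightarrow> real) \<Rightarrow> bool" where
  "supermodular_on N f \<longleftrightarrow>
    (\<forall>r\<in>N. \<forall>t\<in>N. r \<noteq> t \<longrightarrow>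
      (\<forall>S \<subseteq> N - {r, t}. f (S \<union> {r}) - f S \<le> f (S \<union> {r, t}) - f (S \<union> {t})))"

definition supermodular_on_vertices ::
    "nat \<Rightarrow> real \<Rightarrow> real \<Rightarrow> ((nat \<Rightarrow> real) \<Rightarrow> real) \<Rightarrow> bool" where
  "supermodular_on_vertices n l u g \<longleftrightarrow> supermodular_on {1..n} (\<lambda>A. g (vertex n l u A))"

definition beta :: "nat \<Rightarrow> real \<Rightarrow> real \<Rightarrow> (nat \<Rightarrow> real) \<Rightarrow> nat \<Rightarrow> real" where
  "beta n l u c j =
    (sym_multilinear n c (xpt n l u j) - sym_multilinear n c (xpt n l u (j - 1))) / (u - l)"

text \<open>
  Inequality (A) is \<open>lhs_A n l u c x y \<ge> 0\<close> and inequality (B\<open>\<^sub>k\<close>) is \<open>lhs_B n l u c k x y \<ge> 0\<close>;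
  to satisfy one of them exactly is to satisfy it with equality.
\<close>

definition lhs_A :: "nat \<Rightarrow> real \<Rightarrow> real \<Rightarrow> (nat \<Rightarrow> real) \<Rightarrow> (nat \<Rightarrow> real) \<Rightarrow> real \<Rightarrow> real" where
  "lhs_A n l u c x y =
    (u * sym_multilinear n c (xpt n l u 0) - l * sym_multilinear n c (xpt n l u n)) / (u - l)
    + (\<Sum>j = 1..n. beta n l u c j * x j) - y"

definition lhs_B ::
    "nat \<Rightarrow> real \<Rightarrow> real \<Rightarrow> (nat \<Rightarrow> real) \<Rightarrow> nat \<Rightarrow> (nat \<Rightarrow> real) \<Rightarrow> real \<Rightarrow> real" where
  "lhs_B n l u c k x y =
    - sym_multilinear n c (xpt n l u k)
    - ((sym_multilinear n c (xpt n l u k) - sym_multilinear n c (xpt n l u (k - 1))) / (u - l))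
      * ((\<Sum>j = 1..n. x j) - (real k * u + (real n - real k) * l))
    + y"

definition satisfies_A_exactly ::
    "nat \<Rightarrow> real \<Rightarrow> real \<Rightarrow> (nat \<Rightarrow> real) \<Rightarrow> (nat \<Rightarrow> real) \<times> real \<Rightarrow> bool" where
  "satisfies_A_exactly n l u c = (\<lambda>(x, y). lhs_A n l u c x y = 0)"

definition satisfies_B_exactly ::
    "nat \<Rightarrow> real \<Rightarrow> real \<Rightarrow> (nat \<Rightarrow> real) \<Rightarrow> nat \<Rightarrow> (nat \<Rightarrow> real) \<times> real \<Rightarrow> bool" where
  "satisfies_B_exactly n l u c k = (\<lambda>(x, y). lhs_B n l u c k x y = 0)"

text \<open>
  \<open>\<beta>\<^sub>r = \<dots> = \<beta>\<^sub>s\<close>. If one of the two index sets is empty (so that \<open>Min\<close> or \<open>Max\<close> is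
  unspecified), or if \<open>r > s\<close>, then \<open>x\<close> is some \<open>x\<^sup>k\<close>; in the theorem this condition occurs only
  as the alternative to \<open>x\<close> being such a point, so its value in these cases is immaterial.
\<close>

definition betas_equal ::
    "nat \<Rightarrow> real \<Rightarrow> real \<Rightarrow> (nat \<Rightarrow> real) \<Rightarrow> (nat \<Rightarrow> real) \<Rightarrow> bool" where
  "betas_equal n l u c x \<longleftrightarrow>
    (let r = Min {j \<in> {1..n}. x j < u}; s = Max {j \<in> {1..n}. x j > l}
     in \<forall>i\<in>{r..s}. \<forall>j\<in>{r..s}. beta n l u c i = beta n l u c j)"

end

theory Submission imports Defs begin

text \<open>
  Put \<open>z\<^sub>j = (x\<^sub>j - l) / (u - l)\<close> and let each \<open>j\<close> enter a random set \<open>S\<close> independently with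
  probability \<open>z\<^sub>j\<close>. The random vertex belonging to \<open>S\<close> has mean \<open>x\<close>, and since \<open>m\<close> is
  multilinear and the coordinates are independent, its expected \<open>m\<close>-value is \<open>m(x)\<close>. Therefore
  the left-hand side of (A) or of (B\<open>\<^sub>k\<close>) at \<open>(x, m(x))\<close> is the mean of its values at the
  vertices (lemma \<open>vertex_expansion\<close>). When these values are nonnegative, the inequality
  is tight at \<open>x\<close> iff it is tight at every vertex that occurs with positive probability, that is,
  at every \<open>S\<close> with \<open>{j. x\<^sub>j = u} \<subseteq> S \<subseteq> {j. x\<^sub>j > l}\<close>: the vertices of the smallest face of the
  box containing \<open>x\<close> (lemma \<open>tight_iff_tight_on_face\<close>).

  By symmetry \<open>m\<close> at the vertex of \<open>S\<close> depends on \<open>|S|\<close> only, so supermodularity says that the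
  sequence \<open>m(x\<^sup>0), \<dots>, m(x\<^sup>n)\<close> is convex, i.e. that \<open>\<beta>\<close> is nondecreasing.

  For (B\<open>\<^sub>k\<close>), the value at \<open>S\<close> is the gap at \<open>|S|\<close> between this convex sequence and its
  supporting line through \<open>k - 1\<close> and \<open>k\<close>, which is nonnegative. The sizes \<open>|S|\<close> on the face
  of \<open>x\<close> run through \<open>p, \<dots>, n - q\<close>, which gives the second claim; the zeros of the gap form an
  interval \<open>{v..w}\<close>, which gives the third.

  For (A), the value at \<open>S\<close> is a positive multiple of
  \<open>\<Sum>j\<in>S. \<beta>\<^sub>j - \<Sum>j=1..|S|. \<beta>\<^sub>j\<close>, which is nonnegative because \<open>\<beta>\<close> is nondecreasing. If \<open>x\<close>
  is no \<open>x\<^sup>k\<close>, then \<open>r \<le> s\<close> and every \<open>S\<close> on the face satisfies \<open>{1..<r} \<subseteq> S \<subseteq> {1..s}\<close>, so the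
  difference vanishes when \<open>\<beta>\<close> is constant on \<open>{r..s}\<close>. Conversely, if \<open>r < s\<close>, some \<open>S\<close> on the
  face contains \<open>s\<close> but not \<open>r\<close>; exchanging \<open>s\<close> for \<open>r\<close> cannot push the difference below zero,
  which forces \<open>\<beta>\<^sub>r = \<beta>\<^sub>s\<close>.
\<close>

section \<open>The random vertex\<close>

text \<open>
  The probability of \<open>S\<close> when each \<open>j\<close> is drawn independently with probability
  \<open>(x\<^sub>j - l) / (u - l)\<close>, the one that makes the mean of the \<open>j\<close>-th vertex entry equal to \<open>x\<^sub>j\<close>.
\<close>

definition vertex_weight :: "nat \<Rightarrow> real \<Rightarrow> real \<Rightarrow> (nat \<Rightarrow> real) \<Rightarrow> nat set \<Rightarrow> real" where
  "vertex_weight n l u x S =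
    (\<Prod>j\<in>S. (x j - l) / (u - l)) * (\<Prod>j\<in>{1..n} - S. (u - x j) / (u - l))"

text \<open>
  Independence: the sum over \<open>S\<close> is the expanded product of the one-coordinate means, which are
  \<open>x\<^sub>j\<close> for \<open>j \<in> J\<close> and \<open>1\<close> otherwise.
\<close>

lemma mean_vertex_monomial:
  assumes "l < u" and "J \<subseteq> {1..n}"
  shows "(\<Sum>S\<in>Pow {1..n}. vertex_weight n l u x S * (\<Prod>j\<in>J. vertex n l u S j)) = (\<Prod>j\<in>J. x j)"
proof -
  define a where "a j = (x j - l) / (u - l) * (if j \<in> J then u else 1)" for j
  define b where "b j = (u - x j) / (u - l) * (if j \<in> J then l else 1)" for j
  have restrict: "(\<Prod>j\<in>J. f j) = (\<Prod>j\<in>{1..n}. if j \<in> J then f j else 1)" for f :: "nat \<Rightarrow> real"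
    using assms(2) by (simp add: prod.inter_restrict[symmetric] Int_absorb1)
  have "vertex_weight n l u x S * (\<Prod>j\<in>J. vertex n l u S j)
      = (\<Prod>j\<in>S. a j) * (\<Prod>j\<in>{1..n} - S. b j)" if S: "S \<in> Pow {1..n}" for S
  proof -
    have "(\<Prod>j\<in>J. vertex n l u S j)
        = (\<Prod>j\<in>{1..n} - S. if j \<in> J then vertex n l u S j else 1)
          * (\<Prod>j\<in>S. if j \<in> J then vertex n l u S j else 1)"
      using S unfolding restrict by (intro prod.subset_diff) auto
    also have "(\<Prod>j\<in>{1..n} - S. if j \<in> J then vertex n l u S j else 1)
        = (\<Prod>j\<in>{1..n} - S. if j \<in> J then l else 1)"
      by (intro prod.cong) (auto simp: vertex_def)
    also have "(\<Prod>j\<in>S. if j \<in> J then vertex n l u S j else 1) = (\<Prod>j\<in>S. if j \<in> J then u else 1)"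
      using S by (intro prod.cong) (auto simp: vertex_def)
    finally show ?thesis
      by (simp only: vertex_weight_def a_def b_def prod.distrib mult_ac)
  qed
  hence "(\<Sum>S\<in>Pow {1..n}. vertex_weight n l u x S * (\<Prod>j\<in>J. vertex n l u S j))
      = (\<Prod>j\<in>{1..n}. a j + b j)"
    by (simp add: prod_add)
  also have "\<dots> = (\<Prod>j\<in>{1..n}. if j \<in> J then x j else 1)"
    using assms(1) by (intro prod.cong) (auto simp: a_def b_def divide_simps, auto simp: algebra_simps)
  finally show ?thesis by (simp add: restrict)
qed

text \<open>
  \<open>F\<close> is a linear combination of the constant \<open>1\<close>, the coordinates and the squarefree monomials
  that make up \<open>m\<close>, and the mean reproduces each of them.
\<close>

lemma vertex_expansion:
  fixes n :: nat and a e :: real and b c :: "nat \<Rightarrow> real"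
  assumes "l < u"
  defines "F \<equiv> \<lambda>x. a + (\<Sum>j = 1..n. b j * x j) + e * sym_multilinear n c x"
  shows "F x = (\<Sum>S\<in>Pow {1..n}. vertex_weight n l u x S * F (vertex n l u S))"
proof -
  let ?w = "vertex_weight n l u x" and ?V = "vertex n l u"
  have const: "(\<Sum>S\<in>Pow {1..n}. ?w S) = 1"
    using mean_vertex_monomial[OF assms(1), of "{}" n x] by simp
  have coord: "(\<Sum>S\<in>Pow {1..n}. ?w S * ?V S j) = x j" if "j \<in> {1..n}" for j
    using mean_vertex_monomial[OF assms(1), of "{j}" n x] that by simp
  have lin: "(\<Sum>S\<in>Pow {1..n}. ?w S * (\<Sum>j = 1..n. b j * ?V S j)) = (\<Sum>j = 1..n. b j * x j)"
  proof -
    have "(\<Sum>S\<in>Pow {1..n}. ?w S * (\<Sum>j = 1..n. b j * ?V S j))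
        = (\<Sum>j = 1..n. \<Sum>S\<in>Pow {1..n}. b j * (?w S * ?V S j))"
      by (subst sum.swap) (simp add: sum_distrib_left mult_ac)
    also have "\<dots> = (\<Sum>j = 1..n. b j * x j)"
      by (intro sum.cong refl) (simp only: sum_distrib_left[symmetric] coord)
    finally show ?thesis .
  qed
  have mult: "(\<Sum>S\<in>Pow {1..n}. ?w S * sym_multilinear n c (?V S)) = sym_multilinear n c x"
  proof -
    have "(\<Sum>S\<in>Pow {1..n}. ?w S * sym_multilinear n c (?V S))
        = (\<Sum>S\<in>Pow {1..n}. \<Sum>i = 2..n. \<Sum>J | J \<subseteq> {1..n} \<and> card J = i.
              c i * (?w S * (\<Prod>j\<in>J. ?V S j)))"
      by (simp add: sym_multilinear_def sum_distrib_left mult_ac)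
    also have "\<dots> = (\<Sum>i = 2..n. \<Sum>J | J \<subseteq> {1..n} \<and> card J = i. \<Sum>S\<in>Pow {1..n}.
              c i * (?w S * (\<Prod>j\<in>J. ?V S j)))"
      by (rule trans[OF sum.swap], rule sum.cong[OF refl], rule sum.swap)
    also have "\<dots> = (\<Sum>i = 2..n. \<Sum>J | J \<subseteq> {1..n} \<and> card J = i. c i * (\<Prod>j\<in>J. x j))"
      by (intro sum.cong refl)
        (simp only: sum_distrib_left[symmetric] mem_Collect_eq mean_vertex_monomial[OF assms(1)])
    finally show ?thesis by (simp add: sym_multilinear_def sum_distrib_left)
  qed
  have "(\<Sum>S\<in>Pow {1..n}. ?w S * F (?V S))
      = a * (\<Sum>S\<in>Pow {1..n}. ?w S) + (\<Sum>S\<in>Pow {1..n}. ?w S * (\<Sum>j = 1..n. b j * ?V S j))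
        + e * (\<Sum>S\<in>Pow {1..n}. ?w S * sym_multilinear n c (?V S))"
    unfolding F_def distrib_left sum.distrib by (simp add: sum_distrib_left mult_ac)
  thus ?thesis unfolding const lin mult by (simp add: F_def)
qed

lemma vertex_weight_nonneg:
  assumes "l < u" and "x \<in> box n l u" and "S \<subseteq> {1..n}"
  shows "vertex_weight n l u x S \<ge> 0"
  using assms unfolding vertex_weight_def box_def
  by (intro mult_nonneg_nonneg prod_nonneg) (auto simp: PiE_iff)

lemma vertex_weight_eq_0_iff:
  assumes "l < u" and "x \<in> box n l u" and "S \<subseteq> {1..n}"
  shows "vertex_weight n l u x S = 0 \<longleftrightarrow>
    \<not> ({j \<in> {1..n}. x j = u} \<subseteq> S \<and> S \<subseteq> {j \<in> {1..n}. x j > l})"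
proof -
  have fin: "finite S" using assms(3) finite_subset by blast
  have bounds: "l < x j \<longleftrightarrow> x j \<noteq> l" if "j \<in> {1..n}" for j
    using assms(2) that by (auto simp: box_def PiE_iff order.strict_iff_order)
  have "vertex_weight n l u x S = 0 \<longleftrightarrow> (\<exists>j\<in>S. x j = l) \<or> (\<exists>j\<in>{1..n} - S. x j = u)"
    using fin assms(1) by (auto simp: vertex_weight_def)
  also have "(\<exists>j\<in>S. x j = l) \<longleftrightarrow> \<not> S \<subseteq> {j \<in> {1..n}. x j > l}"
    using assms(3) bounds by blast
  finally show ?thesis by blast
qed

text \<open>A mean of nonnegative numbers vanishes iff every number of positive weight does.\<close>

lemma tight_iff_tight_on_face:
  fixes n :: nat and a e :: real and b c :: "nat \<Rightarrow> real"
  assumes "l < u" and "x \<in> box n l u"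
  defines "F \<equiv> \<lambda>x. a + (\<Sum>j = 1..n. b j * x j) + e * sym_multilinear n c x"
  assumes nonneg: "\<And>S. S \<subseteq> {1..n} \<Longrightarrow> F (vertex n l u S) \<ge> 0"
  shows "F x = 0 \<longleftrightarrow>
    (\<forall>S. {j \<in> {1..n}. x j = u} \<subseteq> S \<and> S \<subseteq> {j \<in> {1..n}. x j > l} \<longrightarrow> F (vertex n l u S) = 0)"
proof -
  have "F x = 0 \<longleftrightarrow> (\<Sum>S\<in>Pow {1..n}. vertex_weight n l u x S * F (vertex n l u S)) = 0"
    unfolding F_def by (subst vertex_expansion[OF assms(1)]) (rule refl)
  also have "\<dots> \<longleftrightarrow> (\<forall>S\<in>Pow {1..n}. vertex_weight n l u x S * F (vertex n l u S) = 0)"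
    by (intro sum_nonneg_eq_0_iff)
      (auto intro!: mult_nonneg_nonneg nonneg vertex_weight_nonneg[OF assms(1,2)])
  also have "\<dots> \<longleftrightarrow> (\<forall>S\<in>Pow {1..n}.
      {j \<in> {1..n}. x j = u} \<subseteq> S \<and> S \<subseteq> {j \<in> {1..n}. x j > l} \<longrightarrow> F (vertex n l u S) = 0)"
    using vertex_weight_eq_0_iff[OF assms(1,2)] by auto
  also have "\<dots> \<longleftrightarrow> (\<forall>S. {j \<in> {1..n}. x j = u} \<subseteq> S \<and> S \<subseteq> {j \<in> {1..n}. x j > l} \<longrightarrow>
      F (vertex n l u S) = 0)"
    by blast
  finally show ?thesis .
qed

section \<open>Symmetry and convexity\<close>

lemma xpt_eq_vertex: "xpt n l u k = vertex n l u {1..k}"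
  by (auto simp: xpt_def vertex_def fun_eq_iff)

text \<open>A permutation of \<open>{1..n}\<close> that carries \<open>{1..|S|}\<close> to \<open>S\<close> permutes the monomials.\<close>

lemma sym_multilinear_vertex:
  assumes S: "S \<subseteq> {1..n}"
  shows "sym_multilinear n c (vertex n l u S) = sym_multilinear n c (xpt n l u (card S))"
proof -
  define k where "k = card S"
  have finS: "finite S" using S finite_subset by blast
  have kn: "k \<le> n" using card_mono[OF _ S] by (simp add: k_def)
  obtain f where f: "bij_betw f {1..k} S"
    using finite_same_card_bij[of "{1..k}" S] finS by (auto simp: k_def)
  have "card ({1..n} - {1..k}) = card ({1..n} - S)"
    using S kn finS by (simp add: card_Diff_subset k_def)
  then obtain g where g: "bij_betw g ({1..n} - {1..k}) ({1..n} - S)"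
    using finite_same_card_bij[of "{1..n} - {1..k}" "{1..n} - S"] by auto
  define h where "h j = (if j \<in> {1..k} then f j else g j)" for j
  have "bij_betw h ({1..k} \<union> ({1..n} - {1..k})) (S \<union> ({1..n} - S))"
    unfolding h_def by (rule bij_betw_disjoint_Un[OF f g]) auto
  moreover have "{1..k} \<union> ({1..n} - {1..k}) = {1..n}" "S \<union> ({1..n} - S) = {1..n}"
    using kn S by auto
  ultimately have h: "bij_betw h {1..n} {1..n}" by metis
  have mem: "h j \<in> S \<longleftrightarrow> j \<le> k" if "j \<in> {1..n}" for j
    using bij_betw_apply[OF f, of j] bij_betw_apply[OF g, of j] that by (auto simp: h_def)
  have hn: "h j \<in> {1..n}" if "j \<in> {1..n}" for j
    using h that by (auto simp: bij_betw_def)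
  have val: "vertex n l u S (h j) = xpt n l u k j" if "j \<in> {1..n}" for j
    using mem[OF that] hn[OF that] that by (auto simp: vertex_def xpt_def)
  have "(\<Sum>J | J \<subseteq> {1..n} \<and> card J = i. \<Prod>j\<in>J. vertex n l u S j)
      = (\<Sum>J | J \<subseteq> {1..n} \<and> card J = i. \<Prod>j\<in>J. xpt n l u k j)" for i
  proof -
    have inj: "inj_on h J" if "J \<subseteq> {1..n}" for J
      using h that by (auto simp: bij_betw_def intro: inj_on_subset)
    have "bij_betw (image h) {J \<in> Pow {1..n}. card J = i} {J \<in> Pow {1..n}. card J = i}"
    proof (rule bij_betw_subset[OF bij_betw_Pow[OF h]])
      show "image h ` {J \<in> Pow {1..n}. card J = i} = {J \<in> Pow {1..n}. card J = i}"
      proof (intro subset_antisym subsetI)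
        fix K assume K: "K \<in> {J \<in> Pow {1..n}. card J = i}"
        then obtain J where J: "J \<subseteq> {1..n}" "K = h ` J"
          using h unfolding bij_betw_def by (metis (lifting) PowD mem_Collect_eq subset_imageE)
        have "card J = i" using K J inj[OF J(1)] by (simp add: card_image)
        thus "K \<in> image h ` {J \<in> Pow {1..n}. card J = i}" using J by auto
      next
        fix K assume "K \<in> image h ` {J \<in> Pow {1..n}. card J = i}"
        thus "K \<in> {J \<in> Pow {1..n}. card J = i}"
          using inj hn by (auto simp: card_image)
      qed
    qed auto
    hence "(\<Sum>J | J \<subseteq> {1..n} \<and> card J = i. \<Prod>j\<in>J. vertex n l u S j)
        = (\<Sum>J | J \<subseteq> {1..n} \<and> card J = i. \<Prod>j\<in>h ` J. vertex n l u S j)"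
      by (subst sum.reindex_bij_betw[symmetric]) auto
    also have "\<dots> = (\<Sum>J | J \<subseteq> {1..n} \<and> card J = i. \<Prod>j\<in>J. xpt n l u k j)"
    proof (intro sum.cong refl)
      fix J assume "J \<in> {J. J \<subseteq> {1..n} \<and> card J = i}"
      hence J: "J \<subseteq> {1..n}" by auto
      show "(\<Prod>j\<in>h ` J. vertex n l u S j) = (\<Prod>j\<in>J. xpt n l u k j)"
        unfolding prod.reindex[OF inj[OF J]] o_def
        using val J by (intro prod.cong refl) auto
    qed
    finally show ?thesis .
  qed
  thus ?thesis by (simp add: sym_multilinear_def k_def)
qed

text \<open>
  With \<open>S = {1..i - 1}\<close>, \<open>r = i\<close> and \<open>t = i + 1\<close>, supermodularity compares consecutive
  increments, because \<open>S \<union> {t}\<close> has \<open>i\<close> elements.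
\<close>

lemma beta_mono:
  assumes "l < u" and super: "supermodular_on_vertices n l u (sym_multilinear n c)"
  shows "mono_on {1..n} (beta n l u c)"
proof -
  have step: "beta n l u c i \<le> beta n l u c (Suc i)" if i: "1 \<le> i" "i < n" for i
  proof -
    let ?m = "\<lambda>A. sym_multilinear n c (vertex n l u A)"
    have "?m ({1..i - 1} \<union> {i}) - ?m {1..i - 1}
        \<le> ?m ({1..i - 1} \<union> {i, Suc i}) - ?m ({1..i - 1} \<union> {Suc i})"
      using super i unfolding supermodular_on_vertices_def supermodular_on_def
      by (elim ballE[of _ _ i] ballE[of _ _ "Suc i"] impE allE[of _ "{1..i - 1}"]) auto
    moreover have "{1..i - 1} \<union> {i} = {1..i}" "{1..i - 1} \<union> {i, Suc i} = {1..Suc i}"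
      using i by auto
    moreover have "?m ({1..i - 1} \<union> {Suc i}) = sym_multilinear n c (xpt n l u i)"
    proof -
      have "card ({1..i - 1} \<union> {Suc i}) = i" using i by (subst card_Un_disjoint) auto
      thus ?thesis using i by (subst sym_multilinear_vertex) auto
    qed
    ultimately show ?thesis
      using assms(1) by (simp add: beta_def xpt_eq_vertex divide_right_mono)
  qed
  have "beta n l u c i \<le> beta n l u c j" if "i \<le> j" "1 \<le> i" "j \<le> n" for i j
    using that by (induction j rule: dec_induct) (auto intro: order_trans[OF _ step])
  thus ?thesis by (auto intro!: mono_onI)
qed

lemma increment_eq_beta:
  assumes "l < u"
  shows "sym_multilinear n c (xpt n l u (Suc j)) - sym_multilinear n c (xpt n l u j)
    = (u - l) * beta n l u c (Suc j)"
  using assms by (simp add: beta_def)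

lemma m_xpt_eq_sum_beta:
  assumes "l < u"
  shows "sym_multilinear n c (xpt n l u k)
    = sym_multilinear n c (xpt n l u 0) + (u - l) * (\<Sum>j = 1..k. beta n l u c j)"
proof (induction k)
  case (Suc k)
  show ?case
    using Suc increment_eq_beta[OF assms, of n c k] by (simp add: algebra_simps)
qed simp

lemma sum_mult_vertex:
  assumes "S \<subseteq> {1..n}"
  shows "(\<Sum>j = 1..n. f j * vertex n l u S j) = l * (\<Sum>j = 1..n. f j) + (u - l) * (\<Sum>j\<in>S. f j)"
proof -
  have "(\<Sum>j = 1..n. f j * vertex n l u S j)
      = (\<Sum>j = 1..n. l * f j + (if j \<in> S then (u - l) * f j else 0))"
    by (intro sum.cong) (auto simp: vertex_def algebra_simps)
  also have "\<dots> = l * (\<Sum>j = 1..n. f j) + (u - l) * (\<Sum>j\<in>S. f j)"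
    using assms
    by (simp add: sum.distrib sum_distrib_left sum.inter_restrict[symmetric] Int_absorb1)
  finally show ?thesis .
qed

section \<open>The inequalities (B)\<close>

definition tangent_gap ::
    "nat \<Rightarrow> real \<Rightarrow> real \<Rightarrow> (nat \<Rightarrow> real) \<Rightarrow> nat \<Rightarrow> nat \<Rightarrow> real" where
  "tangent_gap n l u c k i =
    sym_multilinear n c (xpt n l u i) - sym_multilinear n c (xpt n l u k)
    - (u - l) * beta n l u c k * (real i - real k)"

lemma lhs_B_vertex:
  assumes "l < u" and "S \<subseteq> {1..n}"
  shows "lhs_B n l u c k (vertex n l u S) (sym_multilinear n c (vertex n l u S))
    = tangent_gap n l u c k (card S)"
proof -
  have "(\<Sum>j = 1..n. vertex n l u S j) = l * n + (u - l) * card S"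
    using sum_mult_vertex[OF assms(2), of "\<lambda>_. 1"] by simp
  hence sums: "(\<Sum>j = 1..n. vertex n l u S j) - (real k * u + (real n - real k) * l)
      = (u - l) * (real (card S) - real k)"
    by (simp add: algebra_simps)
  show ?thesis
    unfolding lhs_B_def sums tangent_gap_def sym_multilinear_vertex[OF assms(2)]
    using assms(1) by (simp add: beta_def)
qed

text \<open>
  The increments of the gap are \<open>(u - l) (\<beta>\<^sub>i - \<beta>\<^sub>k)\<close>, hence nonpositive to the left of \<open>k\<close> and
  nonnegative to the right of it.
\<close>

lemma tangent_gap_step:
  assumes "l < u"
  shows "tangent_gap n l u c k (Suc i) - tangent_gap n l u c k i
    = (u - l) * (beta n l u c (Suc i) - beta n l u c k)"
  using increment_eq_beta[OF assms, of n c i] by (simp add: tangent_gap_def algebra_simps)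

lemma tangent_gap_mono:
  assumes "l < u" and mono: "mono_on {1..n} (beta n l u c)"
    and "k \<le> i" "i \<le> j" "j \<le> n" "1 \<le> k"
  shows "tangent_gap n l u c k i \<le> tangent_gap n l u c k j"
  using assms(4,5)
proof (induction j rule: dec_induct)
  case (step j)
  have "beta n l u c k \<le> beta n l u c (Suc j)"
    using step assms(3,6) by (intro mono_onD[OF mono]) auto
  hence "0 \<le> (u - l) * (beta n l u c (Suc j) - beta n l u c k)"
    using assms(1) by simp
  thus ?case using step tangent_gap_step[OF assms(1), of n c k j] by linarith
qed simp

lemma tangent_gap_antimono:
  assumes "l < u" and mono: "mono_on {1..n} (beta n l u c)"
    and "i \<le> j" "j \<le> k" "k \<le> n"
  shows "tangent_gap n l u c k j \<le> tangent_gap n l u c k i"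
  using assms(3,4)
proof (induction j rule: dec_induct)
  case (step j)
  have "beta n l u c (Suc j) \<le> beta n l u c k"
    using step assms(5) by (intro mono_onD[OF mono]) auto
  hence "(u - l) * (beta n l u c (Suc j) - beta n l u c k) \<le> 0"
    using assms(1) by (simp add: mult_nonneg_nonpos)
  thus ?case using step tangent_gap_step[OF assms(1), of n c k j] by linarith
qed simp

lemma tangent_gap_self: "tangent_gap n l u c k k = 0"
  by (simp add: tangent_gap_def)

lemma tangent_gap_nonneg:
  assumes "l < u" and "mono_on {1..n} (beta n l u c)" and "k \<in> {1..n}" and "i \<le> n"
  shows "tangent_gap n l u c k i \<ge> 0"
  using tangent_gap_mono[OF assms(1,2), of k k i] tangent_gap_antimono[OF assms(1,2), of i k k]
    assms(3,4) tangent_gap_self[of n l u c k] by (cases "k \<le> i") auto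

lemma tangent_gap_zeros_convex:
  assumes "l < u" and "mono_on {1..n} (beta n l u c)" and "k \<in> {1..n}"
    and "tangent_gap n l u c k a = 0" "tangent_gap n l u c k b = 0" "a \<le> j" "j \<le> b" "b \<le> n"
  shows "tangent_gap n l u c k j = 0"
proof -
  have "tangent_gap n l u c k j \<le> 0"
    using tangent_gap_mono[OF assms(1,2), of k j b] tangent_gap_antimono[OF assms(1,2), of a j k]
      assms by (cases "k \<le> j") auto
  moreover have "tangent_gap n l u c k j \<ge> 0"
    using assms by (intro tangent_gap_nonneg) auto
  ultimately show ?thesis by linarith
qed

lemma satisfies_B_exactly_xpt_iff:
  assumes "l < u" and "j \<le> n"
  shows "satisfies_B_exactly n l u c k (xpt n l u j, sym_multilinear n c (xpt n l u j))
    \<longleftrightarrow> tangent_gap n l u c k j = 0"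
  using lhs_B_vertex[OF assms(1), of "{1..j}" n c k] assms(2)
  by (simp add: satisfies_B_exactly_def xpt_eq_vertex)

lemma card_lower_face:
  assumes "l < u" and "x \<in> box n l u"
  shows "card {j \<in> {1..n}. x j > l} = n - card {j \<in> {1..n}. x j = l}"
    and "card {j \<in> {1..n}. x j = u} \<le> card {j \<in> {1..n}. x j > l}"
    and "card {j \<in> {1..n}. x j = l} \<le> n"
proof -
  have "{j \<in> {1..n}. x j > l} = {1..n} - {j \<in> {1..n}. x j = l}"
    using assms(2) by (auto simp: box_def PiE_iff order.order_iff_strict)
  moreover have "card ({1..n} - {j \<in> {1..n}. x j = l}) = card {1..n} - card {j \<in> {1..n}. x j = l}"
    by (rule card_Diff_subset) auto
  ultimately show "card {j \<in> {1..n}. x j > l} = n - card {j \<in> {1..n}. x j = l}"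
    by simp
  show "card {j \<in> {1..n}. x j = u} \<le> card {j \<in> {1..n}. x j > l}"
    using assms(1) by (intro card_mono) auto
  show "card {j \<in> {1..n}. x j = l} \<le> n"
    using card_mono[of "{1..n}" "{j \<in> {1..n}. x j = l}"] by (simp add: subset_iff)
qed

lemma satisfies_B_exactly_iff:
  assumes "l < u" and "mono_on {1..n} (beta n l u c)" and "x \<in> box n l u" and "k \<in> {1..n}"
  shows "satisfies_B_exactly n l u c k (x, sym_multilinear n c x) \<longleftrightarrow>
    (\<forall>i\<in>{card {j \<in> {1..n}. x j = u}..n - card {j \<in> {1..n}. x j = l}}.
      tangent_gap n l u c k i = 0)"
proof -
  let ?F = "{j \<in> {1..n}. x j = u}" and ?E = "{j \<in> {1..n}. x j > l}"
  let ?a = "- sym_multilinear n c (xpt n l u k)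
    + beta n l u c k * (real k * u + (real n - real k) * l)"
  have affine: "lhs_B n l u c k z (sym_multilinear n c z)
      = ?a + (\<Sum>j = 1..n. - beta n l u c k * z j) + 1 * sym_multilinear n c z" for z
    unfolding lhs_B_def beta_def[symmetric] sum_distrib_left[symmetric] by (simp add: algebra_simps)
  have "satisfies_B_exactly n l u c k (x, sym_multilinear n c x) \<longleftrightarrow>
      (\<forall>S. ?F \<subseteq> S \<and> S \<subseteq> ?E \<longrightarrow>
        lhs_B n l u c k (vertex n l u S) (sym_multilinear n c (vertex n l u S)) = 0)"
    unfolding satisfies_B_exactly_def prod.case affine
  proof (rule tight_iff_tight_on_face[OF assms(1,3)])
    fix S assume S: "S \<subseteq> {1..n}"
    have "card S \<le> n" using card_mono[OF _ S] by simp
    thus "0 \<le> ?a + (\<Sum>j = 1..n. - beta n l u c k * vertex n l u S j)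
        + 1 * sym_multilinear n c (vertex n l u S)"
      unfolding affine[symmetric] lhs_B_vertex[OF assms(1) S]
      by (intro tangent_gap_nonneg assms)
  qed
  also have "\<dots> \<longleftrightarrow> (\<forall>S. ?F \<subseteq> S \<and> S \<subseteq> ?E \<longrightarrow> tangent_gap n l u c k (card S) = 0)"
    using lhs_B_vertex[OF assms(1)]
    by (intro all_cong1 imp_cong refl) (metis (no_types, lifting) mem_Collect_eq subset_iff)
  also have "\<dots> \<longleftrightarrow> (\<forall>i\<in>{card ?F..card ?E}. tangent_gap n l u c k i = 0)"
  proof (intro iffI ballI allI impI)
    fix i assume all: "\<forall>S. ?F \<subseteq> S \<and> S \<subseteq> ?E \<longrightarrow> tangent_gap n l u c k (card S) = 0"
      and i: "i \<in> {card ?F..card ?E}"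
    obtain S where "?F \<subseteq> S" "S \<subseteq> ?E" "card S = i"
      using exists_subset_between[of ?F i ?E] i assms(1) by auto
    thus "tangent_gap n l u c k i = 0" using all by blast
  next
    fix S assume "\<forall>i\<in>{card ?F..card ?E}. tangent_gap n l u c k i = 0" and S: "?F \<subseteq> S \<and> S \<subseteq> ?E"
    moreover have "card ?F \<le> card S" "card S \<le> card ?E"
      using S finite_subset[of S ?E] by (auto intro!: card_mono)
    ultimately show "tangent_gap n l u c k (card S) = 0" by simp
  qed
  finally show ?thesis by (simp only: card_lower_face(1)[OF assms(1,3)])
qed

section \<open>The inequality (A)\<close>

lemma lhs_A_vertex:
  assumes "l < u" and S: "S \<subseteq> {1..n}"
  shows "lhs_A n l u c (vertex n l u S) (sym_multilinear n c (vertex n l u S))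
    = (u - l) * ((\<Sum>j\<in>S. beta n l u c j) - (\<Sum>j = 1..card S. beta n l u c j))"
proof -
  let ?B = "\<lambda>k. \<Sum>j = 1..k. beta n l u c j" and ?g = "\<lambda>k. sym_multilinear n c (xpt n l u k)"
  have "(u * ?g 0 - l * ?g n) / (u - l) = ?g 0 - l * ?B n"
    unfolding m_xpt_eq_sum_beta[OF assms(1), of n c n]
    using assms(1) by (simp add: divide_simps) (simp add: algebra_simps)
  thus ?thesis
    unfolding lhs_A_def sum_mult_vertex[OF S] sym_multilinear_vertex[OF S]
      m_xpt_eq_sum_beta[OF assms(1), of n c "card S"]
    by (simp add: algebra_simps)
qed

text \<open>The \<open>i\<close>-th smallest element of \<open>S\<close> is at least \<open>i\<close>, so the sums compare term by term.\<close>

lemma sum_initial_segment_le: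
  fixes b :: "nat \<Rightarrow> real"
  assumes mono: "mono_on {1..n} b" and "S \<subseteq> {1..n}"
  shows "(\<Sum>j = 1..card S. b j) \<le> (\<Sum>j\<in>S. b j)"
proof -
  have "finite S" using assms(2) finite_subset by blast
  thus ?thesis using assms(2)
  proof (induction rule: finite_linorder_max_induct)
    case (insert m A)
    have "m \<notin> A" using insert by auto
    have "insert m A \<subseteq> {1..m}" using insert by (auto simp: subset_iff intro: less_imp_le)
    from card_mono[OF _ this] have card: "Suc (card A) \<le> m"
      using insert(1) \<open>m \<notin> A\<close> by simp
    have "b (Suc (card A)) \<le> b m"
      using card insert by (intro mono_onD[OF mono]) auto
    thus ?case using insert \<open>m \<notin> A\<close> by simp
  qed simp
qed

text \<open>
  A set between \<open>{1..<r}\<close> and \<open>{1..s}\<close> picks up every term before \<open>r\<close> and otherwise only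
  terms equal to \<open>d\<close>, so its sum is a function of its size.
\<close>

lemma sum_eq_initial_segment:
  fixes b :: "nat \<Rightarrow> real"
  assumes const: "\<And>j. j \<in> {r..s} \<Longrightarrow> b j = d"
    and "1 \<le> r" "r \<le> s" and S: "{1..<r} \<subseteq> S" "S \<subseteq> {1..s}"
  shows "(\<Sum>j\<in>S. b j) = (\<Sum>j = 1..card S. b j)"
proof -
  have split: "(\<Sum>j\<in>A. b j) = (\<Sum>j = 1..<r. b j) + d * (real (card A) - real (r - 1))"
    if A: "{1..<r} \<subseteq> A" "A \<subseteq> {1..s}" for A
  proof -
    have fin: "finite A" using A finite_subset by blast
    have "(\<Sum>j\<in>A. b j) = (\<Sum>j\<in>A - {1..<r}. b j) + (\<Sum>j = 1..<r. b j)"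
      using A fin by (intro sum.subset_diff) auto
    also have "(\<Sum>j\<in>A - {1..<r}. b j) = (\<Sum>j\<in>A - {1..<r}. d)"
      using A by (intro sum.cong const) auto
    also have "\<dots> = d * (real (card A) - real (r - 1))"
      using A fin card_mono[OF fin A(1)] by (simp add: card_Diff_subset of_nat_diff)
    finally show ?thesis by simp
  qed
  have "r - 1 \<le> card S" using card_mono[OF _ S(1)] S(2) finite_subset by fastforce
  moreover have "card S \<le> s" using card_mono[OF _ S(2)] by simp
  ultimately have "{1..<r} \<subseteq> {1..card S}" "{1..card S} \<subseteq> {1..s}" by auto
  from split[OF this] split[OF S] show ?thesis by simp
qed

lemma satisfies_A_exactly_iff:
  assumes "l < u" and "mono_on {1..n} (beta n l u c)" and "x \<in> box n l u"
  shows "satisfies_A_exactly n l u c (x, sym_multilinear n c x) \<longleftrightarrow>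
    (\<forall>S. {j \<in> {1..n}. x j = u} \<subseteq> S \<and> S \<subseteq> {j \<in> {1..n}. x j > l} \<longrightarrow>
      (\<Sum>j\<in>S. beta n l u c j) = (\<Sum>j = 1..card S. beta n l u c j))"
proof -
  let ?F = "{j \<in> {1..n}. x j = u}" and ?E = "{j \<in> {1..n}. x j > l}"
  let ?a = "(u * sym_multilinear n c (xpt n l u 0) - l * sym_multilinear n c (xpt n l u n)) / (u - l)"
  have affine: "lhs_A n l u c z (sym_multilinear n c z)
      = ?a + (\<Sum>j = 1..n. beta n l u c j * z j) + - 1 * sym_multilinear n c z" for z
    by (simp add: lhs_A_def)
  have "satisfies_A_exactly n l u c (x, sym_multilinear n c x) \<longleftrightarrow>
      (\<forall>S. ?F \<subseteq> S \<and> S \<subseteq> ?E \<longrightarrow>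
        lhs_A n l u c (vertex n l u S) (sym_multilinear n c (vertex n l u S)) = 0)"
    unfolding satisfies_A_exactly_def prod.case affine
  proof (rule tight_iff_tight_on_face[OF assms(1,3)])
    fix S assume S: "S \<subseteq> {1..n}"
    show "0 \<le> ?a + (\<Sum>j = 1..n. beta n l u c j * vertex n l u S j)
        + - 1 * sym_multilinear n c (vertex n l u S)"
      unfolding affine[symmetric] lhs_A_vertex[OF assms(1) S]
      using assms(1) sum_initial_segment_le[OF assms(2) S] by simp
  qed
  also have "\<dots> \<longleftrightarrow> (\<forall>S. ?F \<subseteq> S \<and> S \<subseteq> ?E \<longrightarrow>
      (\<Sum>j\<in>S. beta n l u c j) = (\<Sum>j = 1..card S. beta n l u c j))"
  proof (intro all_cong1 imp_cong refl)
    fix S assume "?F \<subseteq> S \<and> S \<subseteq> ?E"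
    hence "S \<subseteq> {1..n}" by auto
    thus "lhs_A n l u c (vertex n l u S) (sym_multilinear n c (vertex n l u S)) = 0 \<longleftrightarrow>
        (\<Sum>j\<in>S. beta n l u c j) = (\<Sum>j = 1..card S. beta n l u c j)"
      using assms(1) by (subst lhs_A_vertex) auto
  qed
  finally show ?thesis .
qed

lemma box_eq_xptI:
  assumes "x \<in> box n l u"
    and "\<And>j. j \<in> {1..n} \<Longrightarrow> j \<le> k \<Longrightarrow> x j = u" "\<And>j. j \<in> {1..n} \<Longrightarrow> k < j \<Longrightarrow> x j = l"
  shows "x = xpt n l u k"
proof (rule PiE_ext)
  show "x \<in> {1..n} \<rightarrow>\<^sub>E UNIV" using assms(1) by (auto simp: box_def PiE_iff)
  show "xpt n l u k \<in> {1..n} \<rightarrow>\<^sub>E UNIV" by (simp add: xpt_def)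
  show "x j = xpt n l u k j" if "j \<in> {1..n}" for j
    using assms(2,3)[OF that] that by (auto simp: xpt_def)
qed

text \<open>
  Away from the points \<open>x\<^sup>k\<close> the indices \<open>r\<close> and \<open>s\<close> exist with \<open>r \<le> s\<close>: otherwise all entries
  before some position are \<open>u\<close> and all later ones are \<open>l\<close>.
\<close>

lemma Min_le_Max_if_not_xpt:
  assumes box: "x \<in> box n l u" and no: "\<not> (\<exists>k\<in>{0..n}. x = xpt n l u k)"
  defines "R \<equiv> {j \<in> {1..n}. x j < u}" and "E \<equiv> {j \<in> {1..n}. x j > l}"
  shows "R \<noteq> {}" and "E \<noteq> {}" and "Min R \<le> Max E"
proof -
  have fin: "finite R" "finite E" by (auto simp: R_def E_def)
  have notR: "x j = u" if "j \<in> {1..n}" "j \<notin> R" for j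
    using box that by (auto simp: box_def PiE_iff R_def order.order_iff_strict)
  have notE: "x j = l" if "j \<in> {1..n}" "j \<notin> E" for j
    using box that by (auto simp: box_def PiE_iff E_def order.order_iff_strict)
  show "R \<noteq> {}"
  proof
    assume "R = {}"
    hence "x = xpt n l u n" using notR by (intro box_eq_xptI[OF box]) auto
    thus False using no by auto
  qed
  show E: "E \<noteq> {}"
  proof
    assume "E = {}"
    hence "x = xpt n l u 0" using notE by (intro box_eq_xptI[OF box]) auto
    thus False using no by auto
  qed
  show "Min R \<le> Max E"
  proof (rule ccontr)
    assume less: "\<not> Min R \<le> Max E"
    have "x = xpt n l u (Max E)"
    proof (rule box_eq_xptI[OF box])
      fix j assume j: "j \<in> {1..n}"
      show "x j = u" if "j \<le> Max E"
        using that less Min_le[OF fin(1), of j] by (intro notR[OF j]) auto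
      show "x j = l" if "Max E < j"
        using that Max_ge[OF fin(2), of j] by (intro notE[OF j]) auto
    qed
    moreover have "Max E \<in> {0..n}" using Max_in[OF fin(2) E] by (auto simp: E_def)
    ultimately show False using no by blast
  qed
qed

text \<open>
  In the forward direction, if \<open>r < s\<close>, the set \<open>S = {j. x\<^sub>j > l} - {r}\<close> contains \<open>s\<close> but not \<open>r\<close> and is tight;
  exchanging \<open>s\<close> for \<open>r\<close> preserves its size, and the new sum is still at least that
  of the initial segment, so \<open>\<beta>\<^sub>s \<le> \<beta>\<^sub>r\<close>.
\<close>

lemma tight_on_face_iff_betas_equal:
  assumes box: "x \<in> box n l u" and "l < u" and mono: "mono_on {1..n} (beta n l u c)"
    and no: "\<not> (\<exists>k\<in>{0..n}. x = xpt n l u k)"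
  shows "(\<forall>S. {j \<in> {1..n}. x j = u} \<subseteq> S \<and> S \<subseteq> {j \<in> {1..n}. x j > l} \<longrightarrow>
      (\<Sum>j\<in>S. beta n l u c j) = (\<Sum>j = 1..card S. beta n l u c j)) \<longleftrightarrow> betas_equal n l u c x"
    (is "?tight \<longleftrightarrow> _")
proof -
  define b where "b = beta n l u c"
  define F where "F = {j \<in> {1..n}. x j = u}"
  define R where "R = {j \<in> {1..n}. x j < u}"
  define E where "E = {j \<in> {1..n}. x j > l}"
  define r where "r = Min R"
  define s where "s = Max E"
  have fin: "finite R" "finite E" by (auto simp: R_def E_def)
  note ne = Min_le_Max_if_not_xpt[OF box no, folded R_def E_def]
  have r: "r \<in> R" and s: "s \<in> E" and rs: "r \<le> s"
    using ne fin by (auto simp: r_def s_def)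
  have rn: "r \<in> {1..n}" and sn: "s \<in> {1..n}" using r s by (auto simp: R_def E_def)
  have mono_b: "mono_on {1..n} b" using mono by (simp add: b_def)
  have eq: "betas_equal n l u c x \<longleftrightarrow> (\<forall>i\<in>{r..s}. \<forall>j\<in>{r..s}. b i = b j)"
    by (simp add: betas_equal_def Let_def b_def r_def s_def R_def E_def)
  show ?thesis unfolding eq b_def[symmetric] F_def[symmetric] E_def[symmetric]
  proof
    assume const: "\<forall>i\<in>{r..s}. \<forall>j\<in>{r..s}. b i = b j"
    show "\<forall>S. F \<subseteq> S \<and> S \<subseteq> E \<longrightarrow> sum b S = sum b {1..card S}"
    proof (intro allI impI)
      fix S assume S: "F \<subseteq> S \<and> S \<subseteq> E"
      have "{1..<r} \<subseteq> F"
      proof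
        fix j assume j: "j \<in> {1..<r}"
        hence jn: "j \<in> {1..n}" using rn by auto
        have "j \<notin> R" using j Min_le[OF fin(1), of j] by (auto simp: r_def)
        thus "j \<in> F" using box jn by (auto simp: box_def PiE_iff R_def F_def order.order_iff_strict)
      qed
      moreover have "E \<subseteq> {1..s}"
        using Max_ge[OF fin(2)] by (auto simp: s_def E_def)
      ultimately have sub: "{1..<r} \<subseteq> S" "S \<subseteq> {1..s}" using S by auto
      have const_r: "b j = b r" if "j \<in> {r..s}" for j
        using const that rs by (meson atLeastAtMost_iff order_refl)
      show "sum b S = sum b {1..card S}"
        by (rule sum_eq_initial_segment[OF const_r _ rs sub]) (use rn in auto)
    qed
  next
    assume tight: "\<forall>S. F \<subseteq> S \<and> S \<subseteq> E \<longrightarrow> sum b S = sum b {1..card S}"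
    have "b s \<le> b r"
    proof (cases "r = s")
      case False
      define S where "S = E - {r}"
      define S' where "S' = insert r (S - {s})"
      have finS: "finite S" using fin by (simp add: S_def)
      have sS: "s \<in> S" and rS: "r \<notin> S" using s False by (auto simp: S_def)
      have FS: "F \<subseteq> S" "S \<subseteq> E"
        using r \<open>l < u\<close> by (auto simp: S_def F_def E_def R_def)
      have "card S' = card S"
        using finS sS rS card_gt_0_iff[of S] by (auto simp: S'_def card_Diff_singleton)
      moreover have "S' \<subseteq> {1..n}" using rn FS by (auto simp: S'_def E_def)
      ultimately have "sum b {1..card S} \<le> sum b S'"
        using sum_initial_segment_le[OF mono_b, of S'] by simp
      moreover have "sum b S' = sum b S - b s + b r"
        using finS sS rS by (simp add: S'_def sum_diff1)
      moreover have "sum b S = sum b {1..card S}" using tight FS by blast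
      ultimately show ?thesis by linarith
    qed simp
    moreover have "b r \<le> b i" "b i \<le> b s" if "i \<in> {r..s}" for i
      using that rn sn by (auto intro!: mono_onD[OF mono_b])
    ultimately show "\<forall>i\<in>{r..s}. \<forall>j\<in>{r..s}. b i = b j" by (meson order_antisym order_trans)
  qed
qed

section \<open>Characterization of tightness\<close>

theorem theorem5p2:
  fixes n :: nat and l u :: real and c :: "nat \<Rightarrow> real"
    and x :: "nat \<Rightarrow> real" and y :: real
  assumes "n \<ge> 2" and "l < u"
    and "supermodular_on_vertices n l u (sym_multilinear n c)"
    and "(x, y) \<in> graph_set n l u c"
  shows
    "(satisfies_A_exactly n l u c (x, y) \<longleftrightarrow>
        (\<exists>k\<in>{0..n}. x = xpt n l u k) \<or> betas_equal n l u c x)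
     \<and> (\<forall>k\<in>{1..n}. satisfies_B_exactly n l u c k (x, y) \<longleftrightarrow>
          (let p = card {j \<in> {1..n}. x j = u}; q = card {j \<in> {1..n}. x j = l}
           in \<forall>j\<in>{p..n - q}.
                satisfies_B_exactly n l u c k (xpt n l u j, sym_multilinear n c (xpt n l u j))))
     \<and> (\<forall>k\<in>{1..n}. satisfies_B_exactly n l u c k (x, y) \<longleftrightarrow>
          (let T = {j \<in> {0..n}.
                 satisfies_B_exactly n l u c k (xpt n l u j, sym_multilinear n c (xpt n l u j))};
               v = Min T; w = Max T
           in card {j \<in> {1..n}. x j = u} \<ge> v \<and> card {j \<in> {1..n}. x j = l} \<ge> n - w))"
proof -
  have box: "x \<in> box n l u" and y: "y = sym_multilinear n c x"
    using assms(4) by (auto simp: graph_set_def)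
  note lu = \<open>l < u\<close>
  note mono = beta_mono[OF lu assms(3)]
  have A: "satisfies_A_exactly n l u c (x, y) \<longleftrightarrow>
      (\<exists>k\<in>{0..n}. x = xpt n l u k) \<or> betas_equal n l u c x"
  proof (cases "\<exists>k\<in>{0..n}. x = xpt n l u k")
    case True
    then obtain k where k: "k \<le> n" "x = xpt n l u k" by auto
    \<comment> \<open>The face of \<open>x\<^sup>k\<close> is a single vertex.\<close>
    have face: "{j \<in> {1..n}. x j = u} = {1..k}" "{j \<in> {1..n}. x j > l} = {1..k}"
      using k lu by (auto simp: xpt_def split: if_splits)
    have "S = {1..k}" if "{1..k} \<subseteq> S \<and> S \<subseteq> {1..k}" for S using that by blast
    hence "satisfies_A_exactly n l u c (x, y)"
      unfolding y satisfies_A_exactly_iff[OF lu mono box] face by fastforce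
    thus ?thesis using True by simp
  next
    case False
    thus ?thesis
      unfolding y satisfies_A_exactly_iff[OF lu mono box]
        tight_on_face_iff_betas_equal[OF box lu mono False] by simp
  qed
  let ?p = "card {j \<in> {1..n}. x j = u}" and ?q = "card {j \<in> {1..n}. x j = l}"
  have pq: "?p \<le> n - ?q" "?q \<le> n"
    using card_lower_face[OF lu box] by simp_all
  have B: "satisfies_B_exactly n l u c k (x, y) \<longleftrightarrow>
      (\<forall>j\<in>{?p..n - ?q}.
        satisfies_B_exactly n l u c k (xpt n l u j, sym_multilinear n c (xpt n l u j)))"
    if "k \<in> {1..n}" for k
    unfolding y satisfies_B_exactly_iff[OF lu mono box that]
    using satisfies_B_exactly_xpt_iff[OF lu, of _ n c k] by (intro ball_cong refl) auto
  have C: "satisfies_B_exactly n l u c k (x, y) \<longleftrightarrow> Min T \<le> ?p \<and> n - Max T \<le> ?q"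
    if k: "k \<in> {1..n}"
      and T: "T = {j \<in> {0..n}.
        satisfies_B_exactly n l u c k (xpt n l u j, sym_multilinear n c (xpt n l u j))}"
    for k T
  proof -
    have T': "T = {j \<in> {0..n}. tangent_gap n l u c k j = 0}"
      unfolding T using satisfies_B_exactly_xpt_iff[OF lu, of _ n c k] by auto
    have fin: "finite T" by (simp add: T')
    have "k \<in> T" using k by (simp add: T' tangent_gap_self)
    hence ends: "Min T \<in> T" "Max T \<in> T" using fin by (auto intro: Min_in Max_in)
    have mem: "j \<in> T \<longleftrightarrow> Min T \<le> j \<and> j \<le> Max T" for j
    proof
      show "Min T \<le> j \<and> j \<le> Max T" if "j \<in> T" using that fin by simp
      show "j \<in> T" if "Min T \<le> j \<and> j \<le> Max T"
        using tangent_gap_zeros_convex[OF lu mono k, of "Min T" "Max T" j] ends that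
        unfolding T' by auto
    qed
    \<comment> \<open>As \<open>T\<close> is an interval and \<open>p \<le> n - q\<close>, the inclusion is a comparison of endpoints.\<close>
    have "satisfies_B_exactly n l u c k (x, y) \<longleftrightarrow> {?p..n - ?q} \<subseteq> T"
      unfolding y satisfies_B_exactly_iff[OF lu mono box k] T' by auto
    also have "\<dots> \<longleftrightarrow> Min T \<le> ?p \<and> n - ?q \<le> Max T"
    proof
      assume sub: "{?p..n - ?q} \<subseteq> T"
      have "?p \<in> T" "n - ?q \<in> T" using sub pq(1) by (simp_all only: subset_iff atLeastAtMost_iff order_refl)
      thus "Min T \<le> ?p \<and> n - ?q \<le> Max T" using fin by simp
    next
      assume le: "Min T \<le> ?p \<and> n - ?q \<le> Max T"
      show "{?p..n - ?q} \<subseteq> T"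
      proof
        fix j assume "j \<in> {?p..n - ?q}"
        thus "j \<in> T" using le by (intro iffD2[OF mem]) (simp only: atLeastAtMost_iff, linarith)
      qed
    qed
    also have "\<dots> \<longleftrightarrow> Min T \<le> ?p \<and> n - Max T \<le> ?q"
      using pq(2) by linarith
    finally show ?thesis .
  qed
  show ?thesis unfolding Let_def using A B C[OF _ refl] by simp
qed

end
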